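(* Let $G$ be an infinite connected, locally finite, regular graph with its path metric. Then every nonexpansive bijection of $\mathcal{K}(G)$ maps the set of singletons $\{\{v\}:v\in G\}$ onto itself if and only if $G$ has no adjacent twins. In this case, for every nonexpansive bijection $F$ of $\mathcal{K}(G)$ there is an isometry $f\colon G\to G$ such that $F(\{v\})=\{f(v)\}$ for every $v\in G$.
   Context: Graphs are simple, undirected and unweighted. A connected graph is identified with its vertex set and equipped with the path metric (minimal length of a walk). A graph is locally finite if every vertex has finite degree, and regular if all vertices have the same degree. Two distinct vertices $u,v$ are adjacent twins if $\overline{B}(u,1)=\overline{B}(v,1)$, where $\overline{B}(x,1)$ is the closed unit ball at $x$. $\mathcal{K}(G)$ is the set of nonempty compact (equivalently, nonempty finite) subsets of $G$ with the Hausdorff metric. A map $f$ is nonexpansive if $d(f(x),f(y))\le d(x,y)$ for all $x,y$; a nonexpansive bijection of $\mathcal{K}(G)$ is a nonexpansive bijective self-map. *)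

theory Defs
  imports "HOL-Analysis.Abstract_Metric_Spaces" "Graph_Theory.Digraph_Component"
begin

section \<open>Graphs\<close>

text \<open>
  A simple undirected graph, possibly infinite, is a symmetric loop-free relation on its set of
  vertices (\<^locale>\<open>pair_bidirected_digraph\<close>): the edge uv is represented by the two arcs (u,v)
  and (v,u). Hence the neighbours of v correspond to the arcs leaving v, and the degree of v is
  its out-degree. The name \<open>connected\<close> has to be qualified, as it also denotes a topological notion.
\<close>

definition connected_simple_graph :: "'a pair_pre_digraph \<Rightarrow> bool" where
  "connected_simple_graph G \<longleftrightarrow>
     pair_bidirected_digraph G \<and> Digraph_Component.connected (with_proj G)"

definition locally_finite_graph :: "'a pair_pre_digraph \<Rightarrow> bool" where
  "locally_finite_graph G \<longleftrightarrow> (\<forall>v \<in> pverts G. finite (out_arcs (with_proj G) v))"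

text \<open>
  As \<^const>\<open>out_degree\<close> is a natural number (0 for infinite degree), this is the usual notion of
  regularity for locally finite graphs only.
\<close>

definition regular_graph :: "'a pair_pre_digraph \<Rightarrow> bool" where
  "regular_graph G \<longleftrightarrow>
     (\<forall>u \<in> pverts G. \<forall>v \<in> pverts G. out_degree (with_proj G) u = out_degree (with_proj G) v)"

definition path_dist :: "'a pair_pre_digraph \<Rightarrow> 'a \<Rightarrow> 'a \<Rightarrow> real" where
  "path_dist G u v = real (LEAST n. \<exists>p. pre_digraph.awalk (with_proj G) u p v \<and> length p = n)"

definition adjacent_twins :: "'a pair_pre_digraph \<Rightarrow> 'a \<Rightarrow> 'a \<Rightarrow> bool" where
  "adjacent_twins G u v \<longleftrightarrow> u \<in> pverts G \<and> v \<in> pverts G \<and> u \<noteq> v \<and>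
     Metric_space.mcball (pverts G) (path_dist G) u 1 = Metric_space.mcball (pverts G) (path_dist G) v 1"


section \<open>Metric notions\<close>

text \<open>Metric spaces are given by a carrier M and a distance d, as in \<^locale>\<open>Metric_space\<close>.\<close>

definition nonempty_compacts :: "'a set \<Rightarrow> ('a \<Rightarrow> 'a \<Rightarrow> real) \<Rightarrow> 'a set set" where
  "nonempty_compacts M d = {K. compactin (Metric_space.mtopology M d) K \<and> K \<noteq> {}}"

definition hausdorff_dist :: "('a \<Rightarrow> 'a \<Rightarrow> real) \<Rightarrow> 'a set \<Rightarrow> 'a set \<Rightarrow> real" where
  "hausdorff_dist d A B = max (SUP a\<in>A. INF b\<in>B. d a b) (SUP b\<in>B. INF a\<in>A. d a b)"

definition nonexpansive_bijection :: "'a set \<Rightarrow> ('a \<Rightarrow> 'a \<Rightarrow> real) \<Rightarrow> ('a \<Rightarrow> 'a) \<Rightarrow> bool" where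
  "nonexpansive_bijection M d f \<longleftrightarrow>
     bij_betw f M M \<and> (\<forall>x \<in> M. \<forall>y \<in> M. d (f x) (f y) \<le> d x y)"

definition bijective_isometry :: "'a set \<Rightarrow> ('a \<Rightarrow> 'a \<Rightarrow> real) \<Rightarrow> ('a \<Rightarrow> 'a) \<Rightarrow> bool" where
  "bijective_isometry M d f \<longleftrightarrow>
     bij_betw f M M \<and> (\<forall>x \<in> M. \<forall>y \<in> M. d (f x) (f y) = d x y)"


section \<open>Basic facts\<close>

lemma connected_simple_graph_awalk:
  assumes "connected_simple_graph G" "u \<in> pverts G" "v \<in> pverts G"
  shows "\<exists>p. pre_digraph.awalk (with_proj G) u p v"
proof -
  interpret pair_bidirected_digraph G
    using assms(1) by (simp add: connected_simple_graph_def)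
  have "strongly_connected (with_proj G)"
    using assms(1) symmetric_connected_imp_strongly_connected pair_sym_arcs
    unfolding connected_simple_graph_def by blast
  then show ?thesis
    using assms(2,3) reachable_awalk unfolding strongly_connected_def by auto
qed

lemma path_dist_le:
  assumes "pre_digraph.awalk (with_proj G) u p v"
  shows "path_dist G u v \<le> real (length p)"
  unfolding path_dist_def of_nat_le_iff by (rule Least_le) (use assms in blast)

lemma path_dist_awalk:
  assumes "connected_simple_graph G" "u \<in> pverts G" "v \<in> pverts G"
  obtains p where "pre_digraph.awalk (with_proj G) u p v" "path_dist G u v = real (length p)"
proof -
  have "\<exists>n p. pre_digraph.awalk (with_proj G) u p v \<and> length p = n"
    using connected_simple_graph_awalk[OF assms] by blast
  from LeastI_ex[OF this] show ?thesis
    using that unfolding path_dist_def by metis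
qed

lemma awalk_reverse:
  assumes "pair_sym_digraph G" "pre_digraph.awalk (with_proj G) u p v"
  shows "\<exists>q. pre_digraph.awalk (with_proj G) v q u \<and> length q = length p"
proof -
  interpret pair_sym_digraph G by fact
  show ?thesis
    using assms(2)
  proof (induction p arbitrary: u)
    case Nil
    then show ?case by (auto simp: awalk_Nil_iff)
  next
    case (Cons e p)
    then have e: "e \<in> parcs G" "fst e = u" "awalk (snd e) p v"
      by (auto simp: awalk_Cons_iff)
    from Cons.IH[OF e(3)] obtain q where q: "awalk v q (snd e)" "length q = length p" by blast
    have "(snd e, u) \<in> parcs G"
      using e pair_sym_arcs unfolding symmetric_def with_proj_simps by (metis prod.collapse symD)
    then have "awalk (snd e) [(snd e, u)] u"
      by (auto simp: awalk_Cons_iff awalk_Nil_iff dest: in_arcsD1 in_arcsD2)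
    with q show ?case
      by (intro exI[of _ "q @ [(snd e, u)]"]) (auto intro: awalk_appendI)
  qed
qed

lemma Metric_space_path_dist:
  assumes G: "connected_simple_graph G"
  shows "Metric_space (pverts G) (path_dist G)"
proof -
  interpret pair_bidirected_digraph G
    using G by (simp add: connected_simple_graph_def)
  have sym: "pair_sym_digraph G" by unfold_locales
  show ?thesis
  proof
    fix x y show "0 \<le> path_dist G x y" by (simp add: path_dist_def)
  next
    fix x y
    have "(\<exists>p. awalk x p y \<and> length p = n) \<longleftrightarrow> (\<exists>p. awalk y p x \<and> length p = n)" for n
      using awalk_reverse[OF sym] by metis
    then show "path_dist G x y = path_dist G y x" by (simp add: path_dist_def)
  next
    fix x y assume xy: "x \<in> pverts G" "y \<in> pverts G"
    show "path_dist G x y = 0 \<longleftrightarrow> x = y"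
    proof
      assume "path_dist G x y = 0"
      with path_dist_awalk[OF G xy] show "x = y"
        by (metis awalk_Nil_iff length_0_conv of_nat_eq_0_iff)
    next
      assume "x = y"
      then show "path_dist G x y = 0"
        using path_dist_le[of G x "[]" y] xy by (auto simp: awalk_Nil_iff path_dist_def)
    qed
  next
    fix x y z assume xyz: "x \<in> pverts G" "y \<in> pverts G" "z \<in> pverts G"
    obtain p where p: "awalk x p y" "path_dist G x y = real (length p)"
      using path_dist_awalk[OF G xyz(1,2)] by blast
    obtain q where q: "awalk y q z" "path_dist G y z = real (length q)"
      using path_dist_awalk[OF G xyz(2,3)] by blast
    show "path_dist G x z \<le> path_dist G x y + path_dist G y z"
      using path_dist_le[OF awalk_appendI[OF p(1) q(1)]] p(2) q(2) by simp
  qed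
qed

lemma nonempty_compacts_path_dist:
  assumes G: "connected_simple_graph G"
  shows "nonempty_compacts (pverts G) (path_dist G) = {K. K \<subseteq> pverts G \<and> finite K \<and> K \<noteq> {}}"
proof -
  interpret M: Metric_space "pverts G" "path_dist G"
    by (rule Metric_space_path_dist[OF G])
  have "openin M.mtopology S" if "S \<subseteq> pverts G" for S
    unfolding M.openin_mtopology
  proof (intro conjI allI impI)
    fix x assume x: "x \<in> S"
    have "y = x" if "y \<in> M.mball x 1" for y
    proof -
      have xy: "x \<in> pverts G" "y \<in> pverts G" "path_dist G x y < 1"
        using that by (auto simp: M.in_mball)
      then have "path_dist G x y = 0" by (simp add: path_dist_def)
      then show ?thesis using xy M.zero by blast
    qed
    then show "\<exists>r>0. M.mball x r \<subseteq> S" using x by (metis subsetI zero_less_one)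
  qed fact
  then have "M.mtopology = discrete_topology (pverts G)"
    by (metis M.topspace_mtopology discrete_topology_unique openin_subset singletonI
        insert_subset empty_subsetI)
  then show ?thesis
    by (auto simp: nonempty_compacts_def compactin_discrete_topology)
qed

end

theory Submission
  imports Defs "HOL-Combinatorics.Transposition"
begin

text \<open>
  A nonexpansive bijection \<open>F\<close> of the hyperspace maps the closed unit ball around \<open>A\<close> injectively into
  the closed unit ball around \<open>F A\<close>. All these balls are finite, so their sizes can only grow along \<open>F\<close>.

  Let \<open>N\<close> be the common size of the unit balls of \<open>G\<close>. The unit ball around a singleton of the
  hyperspace consists of the nonempty subsets of a unit ball of \<open>G\<close>, so it has \<open>2 ^ N - 1\<close> elements.
  Without adjacent twins every other finite set has a strictly larger unit ball
  (\<open>card_hyperball_less\<close>): by regularity, no unit ball of \<open>G\<close> is then contained in another one. Hence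
  the preimage of a singleton is a singleton. This alone does not keep \<open>F\<close> from sending some
  other singleton to a larger set. But if \<open>F {v} = {w}\<close>, then the unit balls around \<open>{v}\<close> and \<open>{w}\<close> are equally large, so
  \<open>F\<close> maps one onto the other; the \<open>N\<close> singletons in the second come from \<open>N\<close> singletons in the first,
  which are all that it has. So the vertices \<open>v\<close> for which \<open>F {v}\<close> is a singleton are closed under
  passing to neighbours, and connectedness makes this the whole vertex set. The induced bijection of
  vertices maps unit balls onto unit balls, so it is an isometry.

  Conversely, let \<open>u\<close> and \<open>v\<close> be adjacent twins. Then \<open>{u}\<close> and \<open>{u, v}\<close> have the same Hausdorff
  distance to every other finite set, and exchanging them, with everything else fixed, is an isometry
  of the hyperspace which does not preserve the singletons.
\<close>

section \<open>The Hausdorff distance of finite sets\<close>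

lemma hausdorff_dist_le_iff:
  assumes "finite A" "A \<noteq> {}" "finite B" "B \<noteq> {}"
  shows "hausdorff_dist d A B \<le> r \<longleftrightarrow>
    (\<forall>a\<in>A. \<exists>b\<in>B. d a b \<le> r) \<and> (\<forall>b\<in>B. \<exists>a\<in>A. d a b \<le> r)"
  using assms by (simp add: hausdorff_dist_def cSup_eq_Max cInf_eq_Min Min_le_iff)

lemma hausdorff_dist_singletons: "hausdorff_dist d {x} {y} = d x y"
  by (simp add: hausdorff_dist_def)

lemma hausdorff_dist_commute:
  assumes "\<And>x y. d x y = d y x"
  shows "hausdorff_dist d A B = hausdorff_dist d B A"
  by (simp add: hausdorff_dist_def max.commute assms)


section \<open>Unit balls and distances in a connected graph\<close>

locale connected_graph_metric =
  fixes G :: "'a pair_pre_digraph"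
  assumes connected_graph: "connected_simple_graph G"
begin

sublocale graph: pair_bidirected_digraph G
  using connected_graph by (simp add: connected_simple_graph_def)

sublocale Metric_space "pverts G" "path_dist G"
  by (rule Metric_space_path_dist[OF connected_graph])

abbreviation dist where "dist \<equiv> path_dist G"

abbreviation unit_ball where "unit_ball v \<equiv> mcball v 1"

lemma path_dist_ge_1:
  assumes "u \<in> pverts G" "v \<in> pverts G" "u \<noteq> v"
  shows "dist u v \<ge> 1"
proof -
  have "dist u v \<noteq> 0" using assms by simp
  then show ?thesis by (simp add: path_dist_def)
qed

lemma edge_path_dist_le_1:
  assumes "(u, v) \<in> parcs G"
  shows "dist u v \<le> 1"
  using path_dist_le[of G u "[(u, v)]" v] assms
  by (auto simp: graph.awalk_Cons_iff graph.awalk_Nil_iff dest: graph.in_arcsD1 graph.in_arcsD2)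

lemma unit_ball_eq:
  assumes v: "v \<in> pverts G"
  shows "unit_ball v = insert v {w. (v, w) \<in> parcs G}"
proof (intro equalityI subsetI)
  fix w assume "w \<in> unit_ball v"
  then have w: "w \<in> pverts G" "dist v w \<le> 1" by auto
  obtain p where p: "graph.awalk v p w" "dist v w = real (length p)"
    using path_dist_awalk[OF connected_graph v w(1)] by blast
  from p(2) w(2) have "length p = 0 \<or> length p = Suc 0" by linarith
  with p(1) show "w \<in> insert v {w. (v, w) \<in> parcs G}"
    by (auto simp: length_Suc_conv graph.awalk_Cons_iff graph.awalk_Nil_iff)
next
  fix w assume "w \<in> insert v {w. (v, w) \<in> parcs G}"
  then show "w \<in> unit_ball v"
    using v edge_path_dist_le_1 by (auto dest: graph.in_arcsD2)
qed

text \<open>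
  The form in which connectedness is used: a property that passes from a vertex to its neighbours
  spreads along walks.
\<close>

lemma unit_ball_closed_imp_all:
  assumes x: "x \<in> H" "x \<in> pverts G"
    and closed: "\<And>v. v \<in> H \<Longrightarrow> v \<in> pverts G \<Longrightarrow> unit_ball v \<subseteq> H"
  shows "pverts G \<subseteq> H"
proof
  fix y assume y: "y \<in> pverts G"
  obtain p where "graph.awalk x p y"
    using connected_simple_graph_awalk[OF connected_graph x(2) y] by blast
  then show "y \<in> H" using x
  proof (induction p arbitrary: x)
    case Nil
    then show ?case by (simp add: graph.awalk_Nil_iff)
  next
    case (Cons e p)
    then have e: "e \<in> parcs G" "fst e = x" "graph.awalk (snd e) p y"
      by (auto simp: graph.awalk_Cons_iff)
    then have "(x, snd e) \<in> parcs G" by auto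
    then have "snd e \<in> unit_ball x" using unit_ball_eq Cons.prems(3) by simp
    then show ?case using closed Cons e by (meson in_mcball subsetD)
  qed
qed

text \<open>
  The path metric is determined by adjacency: a map that preserves adjacency weakly sends a geodesic to
  a walk, possibly with pauses, of the same length.
\<close>

lemma unit_ball_map_imp_nonexpansive:
  assumes g: "\<And>x. x \<in> pverts G \<Longrightarrow> g x \<in> pverts G"
    and ball: "\<And>x y. x \<in> pverts G \<Longrightarrow> y \<in> unit_ball x \<Longrightarrow> g y \<in> unit_ball (g x)"
    and xy: "x \<in> pverts G" "y \<in> pverts G"
  shows "dist (g x) (g y) \<le> dist x y"
proof -
  obtain p where p: "graph.awalk x p y" "dist x y = real (length p)"
    using path_dist_awalk[OF connected_graph xy] by blast
  from p(1) xy have "dist (g x) (g y) \<le> real (length p)"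
  proof (induction p arbitrary: x)
    case Nil
    then show ?case using g by (simp add: graph.awalk_Nil_iff)
  next
    case (Cons e p)
    then have e: "e \<in> parcs G" "fst e = x" "graph.awalk (snd e) p y"
      by (auto simp: graph.awalk_Cons_iff)
    then have "(x, snd e) \<in> parcs G" by auto
    then have z: "snd e \<in> unit_ball x" using unit_ball_eq Cons.prems(2) by simp
    then have zV: "snd e \<in> pverts G" by simp
    have "dist (g x) (g (snd e)) \<le> 1" using ball[OF Cons.prems(2) z] by simp
    moreover have "dist (g (snd e)) (g y) \<le> real (length p)"
      using Cons.IH e(3) zV Cons.prems(3) by blast
    moreover have "dist (g x) (g y) \<le> dist (g x) (g (snd e)) + dist (g (snd e)) (g y)"
      using triangle g zV Cons.prems by blast
    ultimately show ?case by simp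
  qed
  with p(2) show ?thesis by simp
qed

text \<open>
  The second vertex of a geodesic from \<open>u\<close> to \<open>c\<close> lies in the unit ball of \<open>u\<close>, hence in that of \<open>v\<close>, so
  the geodesic can start at \<open>v\<close> instead.
\<close>

lemma twins_path_dist_le:
  assumes tw: "adjacent_twins G u v" and c: "c \<in> pverts G" "c \<noteq> u"
  shows "dist v c \<le> dist u c"
proof -
  have uv: "u \<in> pverts G" "v \<in> pverts G" "unit_ball u = unit_ball v"
    using tw by (auto simp: adjacent_twins_def)
  obtain p where p: "graph.awalk u p c" "dist u c = real (length p)"
    using path_dist_awalk[OF connected_graph uv(1) c(1)] by blast
  then obtain e q where q: "p = e # q"
    using c(2) by (cases p) (auto simp: graph.awalk_Nil_iff)
  then have e: "e \<in> parcs G" "fst e = u" "graph.awalk (snd e) q c"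
    using p(1) by (auto simp: graph.awalk_Cons_iff)
  then have "(u, snd e) \<in> parcs G" by auto
  then have "snd e \<in> unit_ball v" using unit_ball_eq uv by blast
  then have "snd e \<in> pverts G" "dist v (snd e) \<le> 1" by auto
  then have "dist v c \<le> 1 + dist (snd e) c"
    using triangle[OF uv(2) \<open>snd e \<in> pverts G\<close> c(1)] by linarith
  also have "\<dots> \<le> 1 + real (length q)" using path_dist_le[OF e(3)] by simp
  finally show ?thesis using p(2) q by simp
qed

lemma adjacent_twins_sym: "adjacent_twins G u v \<Longrightarrow> adjacent_twins G v u"
  by (auto simp: adjacent_twins_def)

lemma twins_path_dist_eq:
  assumes "adjacent_twins G u v" "c \<in> pverts G" "c \<noteq> u" "c \<noteq> v"
  shows "dist v c = dist u c"
  using twins_path_dist_le[of u v c] twins_path_dist_le[of v u c] assms adjacent_twins_sym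
  by fastforce

lemma twins_path_dist:
  assumes "adjacent_twins G u v"
  shows "dist u v = 1"
proof -
  have uv: "u \<in> pverts G" "v \<in> pverts G" "u \<noteq> v" "unit_ball u = unit_ball v"
    using assms by (auto simp: adjacent_twins_def)
  then have "v \<in> unit_ball u" by simp
  then show ?thesis using path_dist_ge_1[OF uv(1-3)] by simp
qed


section \<open>Exchanging singletons and pairs of adjacent twins\<close>

abbreviation compacts where "compacts \<equiv> nonempty_compacts (pverts G) dist"

abbreviation hdist where "hdist \<equiv> hausdorff_dist dist"

lemma compacts_iff: "K \<in> compacts \<longleftrightarrow> K \<subseteq> pverts G \<and> finite K \<and> K \<noteq> {}"
  using nonempty_compacts_path_dist[OF connected_graph] by simp

lemma hdist_le_iff:
  assumes "A \<in> compacts" "B \<in> compacts"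
  shows "hdist A B \<le> r \<longleftrightarrow>
    (\<forall>a\<in>A. \<exists>b\<in>B. dist a b \<le> r) \<and> (\<forall>b\<in>B. \<exists>a\<in>A. dist a b \<le> r)"
  using assms by (intro hausdorff_dist_le_iff) (simp_all add: compacts_iff)

text \<open>
  A point \<open>c\<close> of \<open>C\<close> outside \<open>{u, v}\<close> is equally far, at distance at least 1, from both twins. So on either
  side the distance is the maximum of \<open>dist u c\<close> over these \<open>c\<close>: points of \<open>C\<close> inside \<open>{u, v}\<close> contribute
  at most 1. If there is no such \<open>c\<close>, then \<open>C = {v}\<close> and both distances are 1.
\<close>

lemma twins_hdist_eq:
  assumes tw: "adjacent_twins G u v"
    and C: "C \<in> compacts" "C \<noteq> {u}" "C \<noteq> {u, v}"
  shows "hdist {u, v} C = hdist {u} C"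
proof -
  have uv: "u \<in> pverts G" "v \<in> pverts G" "u \<noteq> v"
    using tw by (auto simp: adjacent_twins_def)
  have K: "{u} \<in> compacts" "{u, v} \<in> compacts" using uv by (auto simp: compacts_iff)
  have CV: "C \<subseteq> pverts G" "C \<noteq> {}" using C(1) by (auto simp: compacts_iff)
  note uv1 = twins_path_dist[OF tw]
  have vu1: "dist v u = 1" using uv1 commute by simp
  \<comment> \<open>Two reals with the same upper bounds are equal.\<close>
  have "hdist {u, v} C \<le> r \<longleftrightarrow> hdist {u} C \<le> r" for r
  proof (cases "C = {v}")
    case True
    then show ?thesis
      unfolding hdist_le_iff[OF K(1) C(1)] hdist_le_iff[OF K(2) C(1)] using uv1 vu1 uv by auto
  next
    case False
    then obtain c where c: "c \<in> C" "c \<noteq> u" "c \<noteq> v" using C CV(2) by blast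
    have eq: "dist v x = dist u x" if "x \<in> C" "x \<noteq> u" "x \<noteq> v" for x
      using twins_path_dist_eq[OF tw] that CV by blast
    have ge: "dist u c \<ge> 1" using path_dist_ge_1 uv c CV by blast
    show ?thesis
      unfolding hdist_le_iff[OF K(1) C(1)] hdist_le_iff[OF K(2) C(1)]
    proof (rule iffI)
      assume a: "(\<forall>w\<in>{u, v}. \<exists>x\<in>C. dist w x \<le> r) \<and> (\<forall>x\<in>C. \<exists>w\<in>{u, v}. dist w x \<le> r)"
      have "dist u c \<le> r" using a c eq[OF c] by auto
      then have r: "r \<ge> 1" using ge by linarith
      have "dist u x \<le> r" if x: "x \<in> C" for x
      proof (cases "x = u \<or> x = v")
        case True
        then show ?thesis using r uv uv1 by auto
      next
        case False
        then show ?thesis using a x eq[of x] by auto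
      qed
      then show "(\<forall>w\<in>{u}. \<exists>x\<in>C. dist w x \<le> r) \<and> (\<forall>x\<in>C. \<exists>w\<in>{u}. dist w x \<le> r)"
        using c by blast
    next
      assume a: "(\<forall>w\<in>{u}. \<exists>x\<in>C. dist w x \<le> r) \<and> (\<forall>x\<in>C. \<exists>w\<in>{u}. dist w x \<le> r)"
      then have le: "dist u x \<le> r" if "x \<in> C" for x using that by blast
      then have "dist u c \<le> r" "dist v c \<le> r" using c eq[OF c] by simp_all
      then show "(\<forall>w\<in>{u, v}. \<exists>x\<in>C. dist w x \<le> r) \<and> (\<forall>x\<in>C. \<exists>w\<in>{u, v}. dist w x \<le> r)"
        using c le by blast
    qed
  qed
  then show ?thesis by (meson order_antisym order_refl)
qed

lemma twins_transpose_nonexpansive: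
  assumes tw: "adjacent_twins G u v"
  shows "nonexpansive_bijection compacts hdist (Transposition.transpose {u} {u, v})"
proof -
  have uv: "u \<in> pverts G" "v \<in> pverts G" using tw by (auto simp: adjacent_twins_def)
  have K: "{u} \<in> compacts" "{u, v} \<in> compacts" using uv by (auto simp: compacts_iff)
  have refl: "hdist A A \<le> hdist B C" if ABC: "A \<in> compacts" "B \<in> compacts" "C \<in> compacts" for A B C
  proof -
    obtain b where "b \<in> B" using ABC(2) by (auto simp: compacts_iff)
    then obtain c where "c \<in> C" "dist b c \<le> hdist B C"
      using hdist_le_iff[OF ABC(2,3), of "hdist B C"] by blast
    then have "0 \<le> hdist B C" using nonneg[of b c] by linarith
    moreover have "hdist A A \<le> 0"
      unfolding hdist_le_iff[OF ABC(1,1)] using ABC(1) by (force simp: compacts_iff)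
    ultimately show ?thesis by linarith
  qed
  note sym = hausdorff_dist_commute[of dist, OF commute]
  have "hdist (Transposition.transpose {u} {u, v} A) (Transposition.transpose {u} {u, v} C) \<le> hdist A C"
    if AC: "A \<in> compacts" "C \<in> compacts" for A C
  proof (cases "A = C")
    case True
    have "Transposition.transpose {u} {u, v} A \<in> compacts" using K AC by (auto simp: Transposition.transpose_def)
    then show ?thesis using refl AC True by simp
  next
    case False
    show ?thesis
      using False twins_hdist_eq[OF tw AC(1)] twins_hdist_eq[OF tw AC(2)]
        sym[of A "{u}"] sym[of A "{u, v}"] sym[of "{u}" "{u, v}"]
      by (auto simp: Transposition.transpose_def)
  qed
  moreover have "bij_betw (Transposition.transpose {u} {u, v}) compacts compacts"
    using K by (intro bij_betw_byWitness[where f' = "Transposition.transpose {u} {u, v}"])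
      (auto simp: Transposition.transpose_def)
  ultimately show ?thesis by (simp add: nonexpansive_bijection_def)
qed

lemma twins_move_singletons:
  assumes tw: "adjacent_twins G u v"
  shows "Transposition.transpose {u} {u, v} ` {{w} |w. w \<in> pverts G} \<noteq> {{w} |w. w \<in> pverts G}"
proof
  assume eq: "Transposition.transpose {u} {u, v} ` {{w} |w. w \<in> pverts G} = {{w} |w. w \<in> pverts G}"
  have "u \<in> pverts G" "u \<noteq> v" using tw by (auto simp: adjacent_twins_def)
  then have "{u, v} \<in> Transposition.transpose {u} {u, v} ` {{w} |w. w \<in> pverts G}"
    by (intro image_eqI[of _ _ "{u}"]) auto
  then show False using eq \<open>u \<noteq> v\<close> by (auto simp: doubleton_eq_iff)
qed


section \<open>Unit balls of the hyperspace\<close>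

definition hyperball :: "'a set \<Rightarrow> 'a set set" where
  "hyperball A = {C \<in> compacts. hdist A C \<le> 1}"

lemma mem_hyperball_iff:
  assumes A: "A \<in> compacts" and fin: "\<And>v. v \<in> A \<Longrightarrow> finite (unit_ball v)"
  shows "C \<in> hyperball A \<longleftrightarrow> C \<subseteq> (\<Union>a\<in>A. unit_ball a) \<and> (\<forall>a\<in>A. C \<inter> unit_ball a \<noteq> {})"
    (is "_ \<longleftrightarrow> ?R")
proof -
  have AV: "A \<subseteq> pverts G" "finite A" "A \<noteq> {}" using A by (simp_all add: compacts_iff)
  have "finite (\<Union>a\<in>A. unit_ball a)" using AV(2) fin by blast
  then have "?R \<Longrightarrow> finite C" using finite_subset by blast
  moreover have "?R \<Longrightarrow> C \<subseteq> pverts G" using mcball_subset_mspace by blast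
  moreover have "?R \<Longrightarrow> C \<noteq> {}" using AV(3) by blast
  ultimately have compact: "?R \<Longrightarrow> C \<in> compacts" by (simp add: compacts_iff)
  have "hdist A C \<le> 1 \<longleftrightarrow> ?R" if C: "C \<in> compacts"
  proof -
    have "C \<subseteq> pverts G" using C by (simp add: compacts_iff)
    then have "c \<in> unit_ball a \<longleftrightarrow> dist a c \<le> 1" if "a \<in> A" "c \<in> C" for a c
      using that AV(1) by auto
    then show ?thesis unfolding hdist_le_iff[OF A C] by blast
  qed
  then show ?thesis using compact unfolding hyperball_def by blast
qed

lemma hyperball_singleton:
  assumes "v \<in> pverts G" "finite (unit_ball v)"
  shows "hyperball {v} = Pow (unit_ball v) - {{}}"
proof -
  have "{v} \<in> compacts" using assms by (simp add: compacts_iff)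
  from mem_hyperball_iff[OF this] assms(2) show ?thesis by blast
qed

lemma nonexpansive_image_hyperball:
  assumes "nonexpansive_bijection compacts hdist F" "A \<in> compacts"
  shows "F ` hyperball A \<subseteq> hyperball (F A)" "inj_on F (hyperball A)"
proof -
  have sub: "hyperball A \<subseteq> compacts" by (auto simp: hyperball_def)
  have F: "bij_betw F compacts compacts"
    and contr: "\<And>C. C \<in> compacts \<Longrightarrow> hdist (F A) (F C) \<le> hdist A C"
    using assms by (simp_all add: nonexpansive_bijection_def)
  show "inj_on F (hyperball A)"
    using F sub bij_betw_imp_inj_on inj_on_subset by blast
  show "F ` hyperball A \<subseteq> hyperball (F A)"
  proof
    fix D assume "D \<in> F ` hyperball A"
    then obtain C where C: "D = F C" "C \<in> compacts" "hdist A C \<le> 1"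
      by (auto simp: hyperball_def)
    then have "hdist (F A) D \<le> 1" unfolding C(1) using contr[OF C(2)] by linarith
    then show "D \<in> hyperball (F A)" using C bij_betwE[OF F] by (simp add: hyperball_def)
  qed
qed

end


section \<open>Counting in a regular graph\<close>

locale regular_graph_metric = connected_graph_metric +
  assumes locally_finite: "locally_finite_graph G"
    and regular: "regular_graph G"
begin

lemma unit_ball_out_arcs:
  assumes v: "v \<in> pverts G"
  shows "finite (unit_ball v)" "card (unit_ball v) = Suc (out_degree (with_proj G) v)"
proof -
  let ?N = "{w. (v, w) \<in> parcs G}"
  have arcs: "out_arcs (with_proj G) v = Pair v ` ?N" by (auto simp: out_arcs_def)
  have fin: "finite (out_arcs (with_proj G) v)"
    using locally_finite v by (simp add: locally_finite_graph_def)
  then have N: "finite ?N" unfolding arcs by (rule finite_imageD) (simp add: inj_on_def)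
  then show "finite (unit_ball v)" using unit_ball_eq[OF v] by simp
  have "v \<notin> ?N" using graph.pair_no_loops by fastforce
  then have "card (unit_ball v) = Suc (card ?N)" using N unit_ball_eq[OF v] by simp
  also have "card ?N = out_degree (with_proj G) v"
    unfolding out_degree_def arcs by (simp add: card_image inj_on_def)
  finally show "card (unit_ball v) = Suc (out_degree (with_proj G) v)" .
qed

lemmas finite_unit_ball = unit_ball_out_arcs(1)

lemma card_unit_ball_eq:
  assumes "u \<in> pverts G" "v \<in> pverts G"
  shows "card (unit_ball u) = card (unit_ball v)"
  using assms regular unit_ball_out_arcs(2) unfolding regular_graph_def by metis

text \<open>
  By regularity, two nested unit balls coincide.
\<close>

lemma unit_ball_subset_imp_twins:
  assumes "u \<in> pverts G" "v \<in> pverts G" "unit_ball u \<subseteq> unit_ball v" "u \<noteq> v"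
  shows "adjacent_twins G u v"
  using assms card_subset_eq[OF finite_unit_ball assms(3)] card_unit_ball_eq[OF assms(1,2)]
  by (simp add: adjacent_twins_def)

lemma finite_hyperball:
  assumes A: "A \<in> compacts"
  shows "finite (hyperball A)"
proof (rule finite_subset)
  have fin: "finite (unit_ball v)" if "v \<in> A" for v
    using A that finite_unit_ball compacts_iff by blast
  show "hyperball A \<subseteq> Pow (\<Union>a\<in>A. unit_ball a)"
    using mem_hyperball_iff[OF A fin] by blast
  have "finite A" using A by (simp add: compacts_iff)
  then show "finite (Pow (\<Union>a\<in>A. unit_ball a))" using fin by simp
qed

lemma card_hyperball_singleton:
  assumes "u \<in> pverts G" "v \<in> pverts G"
  shows "card (hyperball {u}) = card (hyperball {v})"
  using assms card_unit_ball_eq[OF assms]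
  by (simp add: hyperball_singleton finite_unit_ball card_Pow)

text \<open>
  Let \<open>U\<close> be the union of the unit balls around the points of \<open>A\<close>. A subset of \<open>U\<close> belongs to the unit
  ball of the hyperspace around \<open>A\<close> if it meets the unit ball around each point of \<open>A\<close>. Every nonempty
  \<open>C \<subseteq> unit_ball a\<close> yields such a set when all of \<open>U - unit_ball a\<close> is added to it: in the absence of
  twins the unit ball around any other point of \<open>A\<close> sticks out of \<open>unit_ball a\<close>. These sets are distinct,
  and there is at least one more, obtained by removing from \<open>U\<close> a point outside \<open>unit_ball a\<close>.
\<close>

lemma card_hyperball_less:
  assumes no_twins: "\<not> (\<exists>u v. adjacent_twins G u v)"
    and A: "A \<in> compacts" and ab: "a \<in> A" "b \<in> A" "a \<noteq> b"
  shows "card (hyperball {a}) < card (hyperball A)"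
proof -
  have AV: "A \<subseteq> pverts G" using A by (simp add: compacts_iff)
  define U where "U = (\<Union>a\<in>A. unit_ball a)"
  define E where "E C = C \<union> (U - unit_ball a)" for C
  note mem = mem_hyperball_iff[OF A finite_unit_ball, folded U_def]
  have not_sub: "\<not> unit_ball c \<subseteq> unit_ball a" if "c \<in> A" "c \<noteq> a" for c
    using unit_ball_subset_imp_twins[of c a] no_twins that AV ab by blast
  have hyp_a: "hyperball {a} = Pow (unit_ball a) - {{}}"
    using hyperball_singleton finite_unit_ball AV ab by blast
  have E_hyp: "E ` hyperball {a} \<subseteq> hyperball A"
  proof
    fix D assume "D \<in> E ` hyperball {a}"
    then obtain C where C: "D = E C" "C \<subseteq> unit_ball a" "C \<noteq> {}" using hyp_a by auto
    have "D \<inter> unit_ball c \<noteq> {}" if c: "c \<in> A" for c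
    proof (cases "c = a")
      case True
      then show ?thesis using C by (auto simp: E_def)
    next
      case False
      then obtain x where "x \<in> unit_ball c" "x \<notin> unit_ball a" using not_sub[OF c] by blast
      then have "x \<in> D \<inter> unit_ball c" using C c unfolding E_def U_def by blast
      then show ?thesis by blast
    qed
    moreover have "D \<subseteq> U" using C ab unfolding E_def U_def by blast
    ultimately show "D \<in> hyperball A" using mem AV by blast
  qed
  have "inj_on E (hyperball {a})"
    unfolding inj_on_def hyp_a E_def by blast
  then have card: "card (E ` hyperball {a}) = card (hyperball {a})" by (rule card_image)
  obtain x where x: "x \<in> unit_ball b" "x \<notin> unit_ball a" using not_sub ab by blast
  have "U - {x} \<in> hyperball A"
  proof -
    \<comment> \<open>In a connected graph with more than one vertex no unit ball is a single point.\<close>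
    have "(U - {x}) \<inter> unit_ball c \<noteq> {}" if c: "c \<in> A" for c
    proof
      assume "(U - {x}) \<inter> unit_ball c = {}"
      then have "unit_ball c \<subseteq> {x}" using c unfolding U_def by blast
      moreover have "c \<in> unit_ball c" using c AV by auto
      ultimately have "unit_ball c = {c}" by blast
      then have "pverts G \<subseteq> {c}"
        using unit_ball_closed_imp_all[of c "{c}"] c AV by blast
      then show False using ab AV by blast
    qed
    then show ?thesis using mem AV by blast
  qed
  moreover have "x \<in> E C" for C using x ab unfolding E_def U_def by blast
  then have "U - {x} \<notin> E ` hyperball {a}" by blast
  ultimately have "E ` hyperball {a} \<subset> hyperball A" using E_hyp by blast
  then show ?thesis using psubset_card_mono[OF finite_hyperball[OF A]] card by metis
qed

lemma preimage_singleton: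
  assumes no_twins: "\<not> (\<exists>u v. adjacent_twins G u v)"
    and F: "nonexpansive_bijection compacts hdist F"
    and A: "A \<in> compacts" "F A = {w}"
  shows "\<exists>v \<in> pverts G. A = {v}"
proof (rule ccontr)
  assume *: "\<not> ?thesis"
  obtain a where a: "a \<in> A" "a \<in> pverts G" using A(1) by (auto simp: compacts_iff)
  then obtain b where b: "b \<in> A" "a \<noteq> b" using * by blast
  have FA: "F A \<in> compacts" using F A(1) unfolding nonexpansive_bijection_def by (meson bij_betwE)
  then have w: "w \<in> pverts G" using A(2) by (simp add: compacts_iff)
  have "card (hyperball A) \<le> card (hyperball (F A))"
    using nonexpansive_image_hyperball[OF F A(1)] finite_hyperball[OF FA] by (metis card_inj_on_le)
  also have "\<dots> = card (hyperball {a})" using A(2) card_hyperball_singleton[OF w a(2)] by simp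
  also have "\<dots> < card (hyperball A)" using card_hyperball_less[OF no_twins A(1) a(1) b] .
  finally show False by simp
qed

text \<open>
  An injection between finite sets of the same size is onto.
\<close>

lemma image_hyperball_singleton:
  assumes F: "nonexpansive_bijection compacts hdist F"
    and v: "v \<in> pverts G" "F {v} = {w}"
  shows "F ` hyperball {v} = hyperball {w}"
proof -
  have K: "{v} \<in> compacts" using v by (simp add: compacts_iff)
  then have FK: "{w} \<in> compacts"
    using F v(2) bij_betwE unfolding nonexpansive_bijection_def by metis
  then have w: "w \<in> pverts G" by (simp add: compacts_iff)
  have "card (F ` hyperball {v}) = card (hyperball {w})"
    using nonexpansive_image_hyperball(2)[OF F K] card_hyperball_singleton[OF v(1) w]
    by (simp add: card_image)
  then show ?thesis
    using card_subset_eq[OF finite_hyperball[OF FK]] nonexpansive_image_hyperball(1)[OF F K] v(2)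
    by simp
qed

lemma singleton_mem_hyperball_iff:
  "v \<in> pverts G \<Longrightarrow> {w} \<in> hyperball {v} \<longleftrightarrow> w \<in> unit_ball v"
  by (simp add: hyperball_singleton finite_unit_ball)

text \<open>
  The \<open>card (unit_ball w)\<close> singletons near \<open>{w}\<close> have preimages near \<open>{v}\<close>, and these preimages are
  singletons. The unit ball of \<open>v\<close> has only as many points, so each of them is used.
\<close>

lemma singleton_image_unit_ball:
  assumes no_twins: "\<not> (\<exists>u v. adjacent_twins G u v)"
    and F: "nonexpansive_bijection compacts hdist F"
    and v: "v \<in> pverts G" "F {v} = {w}"
    and y: "y \<in> unit_ball v"
  shows "\<exists>x. F {y} = {x}"
proof -
  define T where "T = {y \<in> unit_ball v. \<exists>x. F {y} = {x}}"
  have "{v} \<in> compacts" using v by (simp add: compacts_iff)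
  then have "F {v} \<in> compacts" using F bij_betwE unfolding nonexpansive_bijection_def by blast
  then have w: "w \<in> pverts G" using v by (simp add: compacts_iff)
  have "unit_ball w \<subseteq> (\<lambda>y. the_elem (F {y})) ` T"
  proof
    fix x assume "x \<in> unit_ball w"
    then have "{x} \<in> F ` hyperball {v}"
      using image_hyperball_singleton[OF F v] singleton_mem_hyperball_iff[OF w] by blast
    then obtain C where C: "C \<in> hyperball {v}" "F C = {x}" by force
    have "C \<in> compacts" using C(1) by (simp add: hyperball_def)
    then obtain y where "C = {y}" using preimage_singleton[OF no_twins F _ C(2)] by blast
    then have "y \<in> T" "the_elem (F {y}) = x"
      using C singleton_mem_hyperball_iff[OF v(1)] by (auto simp: T_def)
    then show "x \<in> (\<lambda>y. the_elem (F {y})) ` T" by blast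
  qed
  moreover have T: "T \<subseteq> unit_ball v" unfolding T_def by blast
  moreover have "finite T" using T finite_unit_ball[OF v(1)] by (rule finite_subset)
  ultimately have "card (unit_ball w) \<le> card T" by (simp add: surj_card_le)
  then have "T = unit_ball v"
    using T card_unit_ball_eq[OF v(1) w] finite_unit_ball[OF v(1)] by (simp add: card_seteq)
  then show ?thesis using y unfolding T_def by blast
qed

lemma singletons_to_singletons:
  assumes no_twins: "\<not> (\<exists>u v. adjacent_twins G u v)"
    and F: "nonexpansive_bijection compacts hdist F"
    and v: "v \<in> pverts G"
  shows "\<exists>w. F {v} = {w}"
proof -
  have bij: "bij_betw F compacts compacts" using F by (simp add: nonexpansive_bijection_def)
  have "{v} \<in> compacts" using v by (simp add: compacts_iff)
  then obtain A where "A \<in> compacts" "F A = {v}"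
    using bij by (metis bij_betw_imp_surj_on imageE)
  then obtain a where a: "a \<in> pverts G" "F {a} = {v}"
    using preimage_singleton[OF no_twins F] by blast
  have "pverts G \<subseteq> {v. \<exists>w. F {v} = {w}}"
    using a singleton_image_unit_ball[OF no_twins F]
    by (intro unit_ball_closed_imp_all[of a]) auto
  then show ?thesis using v by blast
qed

text \<open>
  The bijection \<open>f\<close> of vertices is nonexpansive because \<open>F\<close> is. Its inverse \<open>g\<close> is nonexpansive because \<open>F\<close>
  maps unit balls around singletons onto unit balls, so that \<open>g\<close> preserves unit balls.
\<close>

lemma induced_isometry:
  assumes no_twins: "\<not> (\<exists>u v. adjacent_twins G u v)"
    and F: "nonexpansive_bijection compacts hdist F"
  shows "\<exists>f. bijective_isometry (pverts G) dist f \<and> (\<forall>v \<in> pverts G. F {v} = {f v})"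
proof -
  let ?V = "pverts G"
  have bij: "bij_betw F compacts compacts" and
    contr: "\<And>A B. A \<in> compacts \<Longrightarrow> B \<in> compacts \<Longrightarrow> hdist (F A) (F B) \<le> hdist A B"
    using F by (simp_all add: nonexpansive_bijection_def)
  have K: "{v} \<in> compacts \<longleftrightarrow> v \<in> ?V" for v by (simp add: compacts_iff)
  obtain f where f: "\<And>v. v \<in> ?V \<Longrightarrow> F {v} = {f v}"
    using singletons_to_singletons[OF no_twins F] by metis
  have fV: "f v \<in> ?V" if "v \<in> ?V" for v
  proof -
    have "F {v} \<in> compacts" using bij_betwE[OF bij] K that by blast
    then show ?thesis using f[OF that] K by simp
  qed
  have inj: "inj_on f ?V"
  proof (rule inj_onI)
    fix x y assume xy: "x \<in> ?V" "y \<in> ?V" "f x = f y"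
    then have "F {x} = F {y}" using f by simp
    then have "{x} = {y}" using inj_onD[OF bij_betw_imp_inj_on[OF bij]] K xy by blast
    then show "x = y" by simp
  qed
  have surj: "?V \<subseteq> f ` ?V"
  proof
    fix w assume "w \<in> ?V"
    then obtain A where A: "A \<in> compacts" "F A = {w}"
      using bij K by (metis bij_betw_imp_surj_on imageE)
    then obtain v where v: "v \<in> ?V" "A = {v}" using preimage_singleton[OF no_twins F] by blast
    then have "w = f v" using A(2) f[OF v(1)] by simp
    then show "w \<in> f ` ?V" using v(1) by blast
  qed
  then have fbij: "bij_betw f ?V ?V" using inj fV by (auto simp: bij_betw_def)
  define g where "g = inv_into ?V f"
  have gV: "g x \<in> ?V" and fg: "f (g x) = x" if "x \<in> ?V" for x
    using that surj inv_into_into[of x f ?V] f_inv_into_f[of x f ?V] unfolding g_def by blast+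
  have gf: "g (f x) = x" if "x \<in> ?V" for x
    using that inj by (simp add: g_def)
  have g_ball: "g y \<in> unit_ball (g x)" if x: "x \<in> ?V" and y: "y \<in> unit_ball x" for x y
  proof -
    have "F {g x} = {x}" using f gV fg x by simp
    then have "{y} \<in> F ` hyperball {g x}"
      using image_hyperball_singleton[OF F gV[OF x]] singleton_mem_hyperball_iff[OF x] y by blast
    then obtain C where C: "C \<in> hyperball {g x}" "F C = {y}" by force
    have "C \<in> compacts" using C(1) by (simp add: hyperball_def)
    then obtain z where z: "z \<in> ?V" "C = {z}"
      using preimage_singleton[OF no_twins F _ C(2)] by blast
    then have "y = f z" using f[OF z(1)] C(2) by simp
    then have "g y = z" using gf[OF z(1)] by simp
    then show ?thesis using C z singleton_mem_hyperball_iff[OF gV[OF x]] by blast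
  qed
  have "dist (f x) (f y) = dist x y" if xy: "x \<in> ?V" "y \<in> ?V" for x y
  proof (rule antisym)
    show "dist (f x) (f y) \<le> dist x y"
      using contr[of "{x}" "{y}"] K xy f[OF xy(1)] f[OF xy(2)]
      by (simp add: hausdorff_dist_singletons)
    have "dist (g (f x)) (g (f y)) \<le> dist (f x) (f y)"
      using unit_ball_map_imp_nonexpansive[OF gV g_ball fV[OF xy(1)] fV[OF xy(2)]] .
    then show "dist x y \<le> dist (f x) (f y)" using gf xy by simp
  qed
  then show ?thesis using fbij f unfolding bijective_isometry_def by blast
qed

end

lemma bijective_image_singletons:
  assumes "bij_betw f V V" "\<And>v. v \<in> V \<Longrightarrow> F {v} = {f v}"
  shows "F ` {{v} |v. v \<in> V} = {{v} |v. v \<in> V}"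
proof -
  have "F ` {{v} |v. v \<in> V} = (\<lambda>v. {v}) ` f ` V" using assms(2) by force
  then show ?thesis using assms(1) by (auto simp: bij_betw_def)
qed

theorem corollary4p15:
  fixes G :: "'a pair_pre_digraph"
  assumes "connected_simple_graph G"
    and "infinite (pverts G)"
    and "locally_finite_graph G"
    and "regular_graph G"
  shows "((\<forall>F. nonexpansive_bijection
                 (nonempty_compacts (pverts G) (path_dist G)) (hausdorff_dist (path_dist G)) F \<longrightarrow>
              F ` {{v} |v. v \<in> pverts G} = {{v} |v. v \<in> pverts G})
           \<longleftrightarrow> \<not> (\<exists>u v. adjacent_twins G u v))
       \<and> (\<not> (\<exists>u v. adjacent_twins G u v) \<longrightarrow>
           (\<forall>F. nonexpansive_bijection
                 (nonempty_compacts (pverts G) (path_dist G)) (hausdorff_dist (path_dist G)) F \<longrightarrow>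
              (\<exists>f. bijective_isometry (pverts G) (path_dist G) f \<and>
                   (\<forall>v \<in> pverts G. F {v} = {f v}))))"
proof -
  interpret regular_graph_metric G
    using assms by unfold_locales
  have preserved: "F ` {{v} |v. v \<in> pverts G} = {{v} |v. v \<in> pverts G}"
    if no_twins: "\<not> (\<exists>u v. adjacent_twins G u v)"
      and F: "nonexpansive_bijection compacts hdist F" for F
  proof -
    obtain f where f: "bij_betw f (pverts G) (pverts G)" "\<And>v. v \<in> pverts G \<Longrightarrow> F {v} = {f v}"
      using induced_isometry[OF no_twins F] by (auto simp: bijective_isometry_def)
    then show ?thesis by (rule bijective_image_singletons)
  qed
  show ?thesis
  proof (intro conjI iffI)
    assume all: "\<forall>F. nonexpansive_bijection compacts hdist F \<longrightarrow>
      F ` {{v} |v. v \<in> pverts G} = {{v} |v. v \<in> pverts G}"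
    show "\<not> (\<exists>u v. adjacent_twins G u v)"
    proof
      assume "\<exists>u v. adjacent_twins G u v"
      then obtain u v where "adjacent_twins G u v" by blast
      from all[rule_format, OF twins_transpose_nonexpansive[OF this]] twins_move_singletons[OF this]
      show False by contradiction
    qed
  next
    assume "\<not> (\<exists>u v. adjacent_twins G u v)"
    then show "\<forall>F. nonexpansive_bijection compacts hdist F \<longrightarrow>
      F ` {{v} |v. v \<in> pverts G} = {{v} |v. v \<in> pverts G}"
      using preserved by simp
  next
    show "\<not> (\<exists>u v. adjacent_twins G u v) \<longrightarrow>
      (\<forall>F. nonexpansive_bijection compacts hdist F \<longrightarrow>
        (\<exists>f. bijective_isometry (pverts G) dist f \<and> (\<forall>v \<in> pverts G. F {v} = {f v})))"
      by (intro impI allI induced_isometry)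
  qed
qed

end
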